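(* Let $F$ be a field, and suppose that for some positive integer $m$ we have $u_F(m)=m\,u_F(1)$. Then for every positive integer $t$, \[ u_F(t)\le \tfrac12\big( t(t-m+2)+\tau(m-\tau) \big)\, u_F(1), \] where $\tau$ is the unique integer satisfying $1\le\tau\le m$ and $\tau\equiv t \pmod m$.
   Context: For a field $F$ and a positive integer $t$, a nontrivial zero of quadratic forms $f_1,\ldots,f_t\in F[x_1,\ldots,x_n]$ is a nonzero $\mathbf a\in F^n$ with $f_j(\mathbf a)=0$ for all $1\le j\le t$. $u_F(t)$ denotes the supremum of those positive integers $n$ for which there exist $t$ quadratic forms over $F$ in $n$ variables with no nontrivial zero. *)

theory Defs
  imports
    "Jordan_Normal_Form.Matrix"
    "HOL-Library.Extended_Nat"
    "HOL-Library.Extended_Real"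
    "HOL-Number_Theory.Cong"
begin

text \<open>Quadratic forms are homogeneous polynomials of degree 2 (possibly zero), given by arbitrary
  coefficients on the monomials \<open>x\<^sub>i x\<^sub>j\<close> with \<open>i \<le> j\<close>, so that characteristic 2 is covered. They are
  represented by the functions they induce on \<open>F\<^sup>n\<close>, which is all that matters for their zeros;
  values outside \<open>carrier_vec n\<close> are irrelevant. Variables are indexed from 0.\<close>

definition quadratic_form :: "nat \<Rightarrow> ('a::field vec \<Rightarrow> 'a) \<Rightarrow> bool" where
  "quadratic_form n f \<longleftrightarrow>
     (\<exists>c :: nat \<Rightarrow> nat \<Rightarrow> 'a. \<forall>x \<in> carrier_vec n.
        f x = (\<Sum>j<n. \<Sum>i\<le>j. c i j * x $ i * x $ j))"

definition nontrivial_zero :: "nat \<Rightarrow> nat \<Rightarrow> (nat \<Rightarrow> 'a::field vec \<Rightarrow> 'a) \<Rightarrow> 'a vec \<Rightarrow> bool" where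
  "nontrivial_zero n t f a \<longleftrightarrow>
     a \<in> carrier_vec n \<and> a \<noteq> 0\<^sub>v n \<and> (\<forall>j\<in>{1..t}. f j a = 0)"

definition u_inv :: "'a::field itself \<Rightarrow> nat \<Rightarrow> enat" where
  "u_inv F t = Sup {enat n | n. n > 0 \<and>
     (\<exists>f :: nat \<Rightarrow> 'a vec \<Rightarrow> 'a.
        (\<forall>j\<in>{1..t}. quadratic_form n (f j)) \<and> (\<nexists>a. nontrivial_zero n t f a))}"

end

theory Submission
  imports Defs
begin

text \<open>If \<open>r\<close> forms have a common zero \<open>v\<close>, then restricting them to the common kernel of the polar
  forms \<open>B\<^sub>j(v, _)\<close> and of a coordinate functional not vanishing at \<open>v\<close> costs \<open>r + 1\<close> dimensions, and any
  totally isotropic subspace found there can be enlarged by \<open>v\<close>. Hence \<open>r\<close> forms in more than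
  \<open>u(r) + (r + 1) d\<close> variables have a totally isotropic subspace of dimension \<open>d + 1\<close>. Applying \<open>m\<close> further
  forms to such a subspace, with \<open>d = u(m)\<close>, gives Leep's inequality
  \<open>u(r + m) \<le> u(r) + (r + 1) u(m)\<close>.
  Disjoint sets of variables give \<open>u(s) + u(t) \<le> u(s + t)\<close>, so \<open>u(m) = m u(1)\<close> forces
  \<open>u(s) \<le> s u(1)\<close> for \<open>s \<le> m\<close>. The bound follows by going from \<open>\<tau>\<close> to \<open>t\<close> in steps of \<open>m\<close>.\<close>

section \<open>Quadratic forms and linear substitutions\<close>

text \<open>The entries at \<open>(i, j)\<close> and \<open>(j, i)\<close> are merged into one term.
  This turns an arbitrary matrix into the triangular coefficients of
  \<open>quadratic_form\<close>.\<close>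

lemma sum_square_eq_sum_triangle:
  fixes g :: "nat \<Rightarrow> nat \<Rightarrow> 'a::comm_monoid_add"
  shows "(\<Sum>i<n. \<Sum>j<n. g i j) = (\<Sum>j<n. \<Sum>i\<le>j. if i < j then g i j + g j i else g i i)"
proof (induction n)
  case (Suc n)
  have "(\<Sum>i\<le>n. if i < n then g i n + g n i else g i i)
      = (\<Sum>i<n. if i < n then g i n + g n i else g i i) + g n n"
    by (simp add: lessThan_Suc_atMost[symmetric])
  also have "\<dots> = (\<Sum>i<n. g i n) + (\<Sum>i<n. g n i) + g n n"
    by (simp add: sum.distrib)
  finally show ?case
    using Suc by (simp add: sum.distrib ac_simps)
qed simp

text \<open>Matrices make linear substitutions easy to handle. \<open>B\<close> is not asked to be
  symmetric, since halving mixed coefficients fails in characteristic 2.\<close>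

lemma quadratic_form_iff_mat:
  "quadratic_form n f \<longleftrightarrow>
     (\<exists>B \<in> carrier_mat n n. \<forall>x \<in> carrier_vec n. f x = x \<bullet> (B *\<^sub>v x))"
proof
  assume "quadratic_form n f"
  then obtain c where c: "\<And>x. x \<in> carrier_vec n \<Longrightarrow> f x = (\<Sum>j<n. \<Sum>i\<le>j. c i j * x $ i * x $ j)"
    unfolding quadratic_form_def by blast
  let ?B = "mat n n (\<lambda>(i, j). if i \<le> j then c i j else 0)"
  have "f x = x \<bullet> (?B *\<^sub>v x)" if x: "x \<in> carrier_vec n" for x
  proof -
    have "x \<bullet> (?B *\<^sub>v x) = (\<Sum>i<n. \<Sum>j<n. if i \<le> j then c i j * x $ i * x $ j else 0)"
      using x by (auto simp: scalar_prod_def sum_distrib_left lessThan_atLeast0 intro!: sum.cong)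
    also have "\<dots> = (\<Sum>j<n. \<Sum>i<n. if i \<le> j then c i j * x $ i * x $ j else 0)"
      by (rule sum.swap)
    also have "\<dots> = (\<Sum>j<n. \<Sum>i\<le>j. c i j * x $ i * x $ j)"
      by (intro sum.cong refl sum.mono_neutral_cong_right) auto
    finally show ?thesis using c[OF x] by simp
  qed
  then show "\<exists>B \<in> carrier_mat n n. \<forall>x \<in> carrier_vec n. f x = x \<bullet> (B *\<^sub>v x)"
    by (intro bexI[of _ ?B]) auto
next
  assume "\<exists>B \<in> carrier_mat n n. \<forall>x \<in> carrier_vec n. f x = x \<bullet> (B *\<^sub>v x)"
  then obtain B where B: "B \<in> carrier_mat n n"
    and f: "\<And>x. x \<in> carrier_vec n \<Longrightarrow> f x = x \<bullet> (B *\<^sub>v x)" by blast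
  let ?c = "\<lambda>i j. if i < j then B $$ (i, j) + B $$ (j, i) else B $$ (i, i)"
  have "f x = (\<Sum>j<n. \<Sum>i\<le>j. ?c i j * x $ i * x $ j)" if x: "x \<in> carrier_vec n" for x
  proof -
    have "f x = (\<Sum>i<n. \<Sum>j<n. B $$ (i, j) * x $ i * x $ j)"
      using x B f[OF x]
      by (auto simp: scalar_prod_def sum_distrib_left lessThan_atLeast0 ac_simps intro!: sum.cong)
    also have "\<dots> = (\<Sum>j<n. \<Sum>i\<le>j. ?c i j * x $ i * x $ j)"
      unfolding sum_square_eq_sum_triangle
      by (intro sum.cong refl) (auto simp: algebra_simps)
    finally show ?thesis .
  qed
  then show "quadratic_form n f"
    unfolding quadratic_form_def by (intro exI[of _ ?c] ballI)
qed

lemma index_mult_mat_vec_sum: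
  assumes "A \<in> carrier_mat n d" "x \<in> carrier_vec d" "i < n"
  shows "(A *\<^sub>v x) $ i = (\<Sum>j<d. A $$ (i, j) * x $ j)"
proof -
  have "(A *\<^sub>v x) $ i = row A i \<bullet> x" using assms by simp
  also have "\<dots> = (\<Sum>j<d. A $$ (i, j) * x $ j)"
    unfolding scalar_prod_def lessThan_atLeast0 using assms by (intro sum.cong) auto
  finally show ?thesis .
qed

text \<open>If \<open>B\<close> represents the form, then \<open>P\<^sup>T * (B * P)\<close>
  represents the composite. \<open>P\<close> is arbitrary: later it is either a basis of a subspace
  or a coordinate projection.\<close>

lemma quadratic_form_mult_mat_vec:
  assumes "quadratic_form n f" and P: "P \<in> carrier_mat n d"
  shows "quadratic_form d (\<lambda>y. f (P *\<^sub>v y))"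
proof -
  obtain B where B: "B \<in> carrier_mat n n"
    and f: "\<And>x. x \<in> carrier_vec n \<Longrightarrow> f x = x \<bullet> (B *\<^sub>v x)"
    using assms(1) unfolding quadratic_form_iff_mat by blast
  let ?C = "P\<^sup>T * (B * P)"
  have "f (P *\<^sub>v y) = y \<bullet> (?C *\<^sub>v y)" if y: "y \<in> carrier_vec d" for y
  proof -
    have "?C *\<^sub>v y = P\<^sup>T *\<^sub>v (B *\<^sub>v (P *\<^sub>v y))"
      using P B y assoc_mult_mat_vec[of "P\<^sup>T" d n "B * P" d y] assoc_mult_mat_vec[OF B P y] by simp
    moreover have "y \<bullet> (P\<^sup>T *\<^sub>v (B *\<^sub>v (P *\<^sub>v y))) = (P *\<^sub>v y) \<bullet> (B *\<^sub>v (P *\<^sub>v y))"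
      using P B y transpose_vec_mult_scalar[of P n d y "B *\<^sub>v (P *\<^sub>v y)"]
      by (metis mult_mat_vec_carrier comm_scalar_prod transpose_carrier_mat)
    ultimately show ?thesis
      using f[of "P *\<^sub>v y"] P y by simp
  qed
  then show ?thesis
    unfolding quadratic_form_iff_mat using P B by (intro bexI[of _ ?C]) auto
qed

text \<open>The vector \<open>w = B\<^sup>T *\<^sub>v v + B *\<^sub>v v\<close> represents the polar
  form with first argument \<open>v\<close>; it collects the two cross terms of the
  expansion.\<close>

lemma quadratic_form_polar:
  assumes "quadratic_form n f" and v: "v \<in> carrier_vec n"
  obtains w where "w \<in> carrier_vec n"
    and "\<And>a x. x \<in> carrier_vec n \<Longrightarrow> f (a \<cdot>\<^sub>v v + x) = a * a * f v + a * (w \<bullet> x) + f x"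
proof -
  obtain B where B: "B \<in> carrier_mat n n"
    and f: "\<And>x. x \<in> carrier_vec n \<Longrightarrow> f x = x \<bullet> (B *\<^sub>v x)"
    using assms(1) unfolding quadratic_form_iff_mat by blast
  let ?w = "B\<^sup>T *\<^sub>v v + B *\<^sub>v v"
  have "f (a \<cdot>\<^sub>v v + x) = a * a * f v + a * (?w \<bullet> x) + f x" if x: "x \<in> carrier_vec n" for a x
  proof -
    have Bv: "B *\<^sub>v v \<in> carrier_vec n" "B *\<^sub>v x \<in> carrier_vec n" "B\<^sup>T *\<^sub>v v \<in> carrier_vec n"
      using B v x by auto
    have 1: "(B\<^sup>T *\<^sub>v v) \<bullet> x = v \<bullet> (B *\<^sub>v x)"
      using transpose_vec_mult_scalar[OF B x v] .
    have 2: "(B *\<^sub>v v) \<bullet> x = x \<bullet> (B *\<^sub>v v)"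
      using Bv x by (metis comm_scalar_prod)
    have "f (a \<cdot>\<^sub>v v + x) = (a \<cdot>\<^sub>v v + x) \<bullet> (a \<cdot>\<^sub>v (B *\<^sub>v v) + B *\<^sub>v x)"
      using f[of "a \<cdot>\<^sub>v v + x"] B v x
      by (simp add: mult_add_distrib_mat_vec[OF B] mult_mat_vec[OF B])
    also have "\<dots> = a * (a * (v \<bullet> (B *\<^sub>v v))) + a * (v \<bullet> (B *\<^sub>v x)) + a * (x \<bullet> (B *\<^sub>v v)) + x \<bullet> (B *\<^sub>v x)"
      using Bv v x
      by (simp add: add_scalar_prod_distrib[of _ n] scalar_prod_add_distrib[of _ n] algebra_simps)
    also have "\<dots> = a * a * f v + a * (?w \<bullet> x) + f x"
      using Bv f v x 1 2 by (simp add: add_scalar_prod_distrib[of _ n] algebra_simps)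
    finally show ?thesis .
  qed
  then show ?thesis using that[of ?w] B v by auto
qed

section \<open>Injective matrices and common kernels\<close>

text \<open>Encodes subspaces: the columns of an injective n by d matrix are a basis of a
  d-dimensional subspace of F^n.\<close>

definition inj_mat :: "'a::field mat \<Rightarrow> bool" where
  "inj_mat P \<longleftrightarrow> (\<forall>y \<in> carrier_vec (dim_col P). P *\<^sub>v y = 0\<^sub>v (dim_row P) \<longrightarrow> y = 0\<^sub>v (dim_col P))"

lemma inj_matD:
  assumes "inj_mat P" "P \<in> carrier_mat n d" "y \<in> carrier_vec d" "P *\<^sub>v y = 0\<^sub>v n"
  shows "y = 0\<^sub>v d"
proof -
  have d: "dim_row P = n" "dim_col P = d" using assms(2) by auto
  show ?thesis using assms(1,3,4) unfolding inj_mat_def d by blast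
qed

lemma inj_mat_mult:
  assumes "inj_mat P" "P \<in> carrier_mat n d" "inj_mat Q" "Q \<in> carrier_mat d e"
  shows "inj_mat (P * Q)"
proof -
  have "y = 0\<^sub>v e" if "y \<in> carrier_vec e" "(P * Q) *\<^sub>v y = 0\<^sub>v n" for y
    using that assms
    by (metis assoc_mult_mat_vec inj_matD mult_mat_vec_carrier)
  then show ?thesis using assms unfolding inj_mat_def by auto
qed

text \<open>The equation \<open>l \<bullet> x = 0\<close> is solved for one coordinate
  \<open>k\<close> with \<open>l $ k \<noteq> 0\<close>, the others being free. If \<open>l\<close>
  is zero, the hyperplane where a coordinate vanishes does.\<close>

lemma ex_inj_mat_kernel_functional:
  fixes l :: "'a::field vec"
  assumes l: "l \<in> carrier_vec e"
  shows "\<exists>Q \<in> carrier_mat e (e - 1). inj_mat Q \<and> (\<forall>y \<in> carrier_vec (e - 1). l \<bullet> (Q *\<^sub>v y) = 0)"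
proof (cases "e = 0")
  case True
  then show ?thesis using l
    by (intro bexI[of _ "0\<^sub>m 0 0"]) (auto simp: inj_mat_def scalar_prod_def)
next
  case False
  obtain k where k: "k < e" and lk: "l $ k = 0 \<Longrightarrow> l = 0\<^sub>v e"
  proof (cases "l = 0\<^sub>v e")
    case True
    then show ?thesis using that[of 0] False by simp
  next
    case False
    then obtain k where "k < e" "l $ k \<noteq> 0"
      using l by (metis carrier_vecD eq_vecI index_zero_vec)
    then show ?thesis using that by blast
  qed
  \<comment> \<open>\<open>s\<close> enumerates the indices other than \<open>k\<close>.\<close>
  define s where "s j = (if j < k then j else Suc j)" for j
  have s: "s j < e" "s j \<noteq> k" if "j < e - 1" for j
    using that k by (auto simp: s_def)
  have inj_s: "s i = s j \<longleftrightarrow> i = j" for i j by (auto simp: s_def)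
  \<comment> \<open>\<open>Q\<close> places \<open>y\<close> in the coordinates other than
    \<open>k\<close> and computes coordinate \<open>k\<close> from the equation. For
    \<open>l = 0\<close> that coordinate is 0.\<close>
  define Q where "Q = mat e (e - 1) (\<lambda>(i, j).
    if i = k then - l $ s j / l $ k else if i = s j then 1 else 0)"
  have Q: "Q \<in> carrier_mat e (e - 1)" by (simp add: Q_def)
  have "y = 0\<^sub>v (e - 1)" if y: "y \<in> carrier_vec (e - 1)" and Qy: "Q *\<^sub>v y = 0\<^sub>v e" for y
  proof (rule eq_vecI)
    fix j assume "j < dim_vec (0\<^sub>v (e - 1))"
    then have j: "j < e - 1" by simp
    have "(Q *\<^sub>v y) $ s j = (\<Sum>i<e - 1. if i = j then y $ i else 0)"
      unfolding index_mult_mat_vec_sum[OF Q y s(1)[OF j]]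
      using s[OF j] j by (intro sum.cong refl) (auto simp: Q_def inj_s)
    also have "\<dots> = y $ j" using j by simp
    finally show "y $ j = 0\<^sub>v (e - 1) $ j" using Qy s[OF j] j by simp
  qed (use y in auto)
  then have "inj_mat Q" using Q unfolding inj_mat_def by auto
  moreover have "l \<bullet> (Q *\<^sub>v y) = 0" if y: "y \<in> carrier_vec (e - 1)" for y
  proof -
    \<comment> \<open>This says that every column of \<open>Q\<close> lies in the kernel of
      \<open>l\<close>.\<close>
    have "Q\<^sup>T *\<^sub>v l = 0\<^sub>v (e - 1)"
    proof (rule eq_vecI)
      fix j assume "j < dim_vec (0\<^sub>v (e - 1))"
      then have j: "j < e - 1" by simp
      have "(Q\<^sup>T *\<^sub>v l) $ j = (\<Sum>i<e. (if i = k then - l $ s j / l $ k * l $ k else 0)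
              + (if i = s j then l $ i else 0))"
        unfolding index_mult_mat_vec_sum[OF transpose_carrier_mat[THEN iffD2, OF Q] l j]
        using s[OF j] j by (intro sum.cong refl) (auto simp: Q_def)
      also have "\<dots> = - l $ s j / l $ k * l $ k + l $ s j"
        using k s[OF j] by (simp add: sum.distrib)
      also have "\<dots> = 0"
        using lk s[OF j] by (cases "l $ k = 0") auto
      finally show "(Q\<^sup>T *\<^sub>v l) $ j = 0\<^sub>v (e - 1) $ j" using j by simp
    qed (simp add: Q_def)
    then have "0 = (Q\<^sup>T *\<^sub>v l) \<bullet> y" using y by simp
    also have "\<dots> = l \<bullet> (Q *\<^sub>v y)" using transpose_vec_mult_scalar[OF Q y l] .
    finally show ?thesis by simp
  qed
  ultimately show ?thesis using Q by blast
qed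

text \<open>Each functional costs at most one dimension: on the kernel already parametrised by
  \<open>P\<close>, the next functional becomes \<open>P\<^sup>T *\<^sub>v l q\<close>, and the
  previous lemma applies to it.\<close>

lemma ex_inj_mat_kernel:
  fixes l :: "nat \<Rightarrow> 'a::field vec"
  assumes "\<And>i. i < q \<Longrightarrow> l i \<in> carrier_vec n"
  shows "\<exists>P \<in> carrier_mat n (n - q). inj_mat P \<and>
           (\<forall>y \<in> carrier_vec (n - q). \<forall>i<q. l i \<bullet> (P *\<^sub>v y) = 0)"
  using assms
proof (induction q)
  case 0
  show ?case
    by (intro bexI[of _ "1\<^sub>m n"]) (auto simp: inj_mat_def)
next
  case (Suc q)
  then obtain P where P: "P \<in> carrier_mat n (n - q)" "inj_mat P"
    and lP: "\<And>y i. y \<in> carrier_vec (n - q) \<Longrightarrow> i < q \<Longrightarrow> l i \<bullet> (P *\<^sub>v y) = 0"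
    by (metis less_SucI)
  have lq: "l q \<in> carrier_vec n" using Suc by simp
  then have "P\<^sup>T *\<^sub>v l q \<in> carrier_vec (n - q)" using P by simp
  from ex_inj_mat_kernel_functional[OF this]
  obtain Q where Q: "Q \<in> carrier_mat (n - q) (n - Suc q)" "inj_mat Q"
    and lQ: "\<And>y. y \<in> carrier_vec (n - Suc q) \<Longrightarrow> (P\<^sup>T *\<^sub>v l q) \<bullet> (Q *\<^sub>v y) = 0"
    by auto
  have "l i \<bullet> ((P * Q) *\<^sub>v y) = 0" if y: "y \<in> carrier_vec (n - Suc q)" and i: "i < Suc q" for y i
  proof -
    have Qy: "Q *\<^sub>v y \<in> carrier_vec (n - q)" using Q y by simp
    have "l i \<bullet> (P *\<^sub>v (Q *\<^sub>v y)) = 0"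
      using lP[OF Qy] lQ[OF y] transpose_vec_mult_scalar[OF P(1) Qy lq] i
      by (auto simp: less_Suc_eq)
    then show ?thesis using P Q y by (simp add: assoc_mult_mat_vec[of _ n "n - q"])
  qed
  then show ?case
    using P Q inj_mat_mult[OF P(2,1) Q(2,1)] by (intro bexI[of _ "P * Q"]) auto
qed

section \<open>Anisotropic systems\<close>

text \<open>Unlike in \<^const>\<open>u_inv\<close>, the number \<open>n\<close> of variables may be 0, which does not affect the supremum.\<close>

definition anisotropic :: "'a::field itself \<Rightarrow> nat \<Rightarrow> nat \<Rightarrow> bool" where
  "anisotropic F t n \<longleftrightarrow> (\<exists>f :: nat \<Rightarrow> 'a vec \<Rightarrow> 'a.
     (\<forall>j\<in>{1..t}. quadratic_form n (f j)) \<and>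
     (\<forall>x \<in> carrier_vec n. (\<forall>j\<in>{1..t}. f j x = 0) \<longrightarrow> x = 0\<^sub>v n))"

lemma anisotropic_0: "anisotropic F t 0"
  unfolding anisotropic_def
proof (intro exI[of _ "\<lambda>_ _. 0"] conjI ballI impI)
  show "quadratic_form 0 (\<lambda>_. 0)" by (simp add: quadratic_form_def)
qed (auto intro: eq_vecI)

lemma u_inv_eq:
  fixes F :: "'a::field itself"
  shows "u_inv F t = Sup {enat n | n. n > 0 \<and> anisotropic F t n}"
proof -
  have "anisotropic F t n \<longleftrightarrow> (\<exists>f :: nat \<Rightarrow> 'a vec \<Rightarrow> 'a.
      (\<forall>j\<in>{1..t}. quadratic_form n (f j)) \<and> (\<nexists>a. nontrivial_zero n t f a))" for n
    unfolding anisotropic_def nontrivial_zero_def by (intro ex_cong1 conj_cong refl) blast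
  then show ?thesis unfolding u_inv_def by presburger
qed

lemma u_inv_le_iff: "u_inv F t \<le> enat N \<longleftrightarrow> (\<forall>n. anisotropic F t n \<longrightarrow> n \<le> N)"
  unfolding u_inv_eq Sup_le_iff
proof (intro iffI allI impI ballI)
  fix n
  assume "\<forall>a\<in>{enat n | n. n > 0 \<and> anisotropic F t n}. a \<le> enat N" and "anisotropic F t n"
  then show "n \<le> N" by (cases "n = 0") auto
qed auto

text \<open>A nonempty set of naturals with finite supremum is finite, so the supremum is a maximum.
  The value 0 is covered by the system in no variables.\<close>

lemma anisotropic_u_inv:
  assumes "u_inv F t = enat k"
  shows "anisotropic F t k"
proof (cases "k = 0")
  case False
  let ?S = "{enat n | n. n > 0 \<and> anisotropic F t n}"
  have Sup: "Sup ?S = enat k" using assms unfolding u_inv_eq .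
  have ne: "?S \<noteq> {}"
  proof
    assume "?S = {}"
    then have "Sup ?S = 0" by (simp only: Sup_empty bot_enat_def)
    then show False using Sup False by (simp add: zero_enat_def)
  qed
  have fin: "finite ?S"
  proof (rule ccontr)
    assume "infinite ?S"
    then have "Sup ?S = \<infinity>" using ne unfolding Sup_enat_def by presburger
    then show False using Sup by simp
  qed
  have "Sup ?S \<in> ?S" using Max_in[OF fin ne] fin ne unfolding Sup_enat_def by presburger
  then show ?thesis unfolding Sup by simp
qed (simp add: anisotropic_0)

section \<open>Systems in disjoint sets of variables\<close>

lemma anisotropic_add:
  assumes "anisotropic TYPE('a::field) s n" and "anisotropic TYPE('a) t k"
  shows "anisotropic TYPE('a) (s + t) (n + k)"
proof -
  obtain f :: "nat \<Rightarrow> 'a vec \<Rightarrow> 'a" where f: "\<And>j. j \<in> {1..s} \<Longrightarrow> quadratic_form n (f j)"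
    and f0: "\<And>x. x \<in> carrier_vec n \<Longrightarrow> (\<And>j. j \<in> {1..s} \<Longrightarrow> f j x = 0) \<Longrightarrow> x = 0\<^sub>v n"
    using assms(1) unfolding anisotropic_def by blast
  obtain g :: "nat \<Rightarrow> 'a vec \<Rightarrow> 'a" where g: "\<And>j. j \<in> {1..t} \<Longrightarrow> quadratic_form k (g j)"
    and g0: "\<And>x. x \<in> carrier_vec k \<Longrightarrow> (\<And>j. j \<in> {1..t} \<Longrightarrow> g j x = 0) \<Longrightarrow> x = 0\<^sub>v k"
    using assms(2) unfolding anisotropic_def by blast
  \<comment> \<open>\<open>P\<close> and \<open>Q\<close> project onto the first \<open>n\<close>
    and the last \<open>k\<close> coordinates.\<close>
  define P :: "'a mat" where "P = mat n (n + k) (\<lambda>(i, j). if j = i then 1 else 0)"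
  define Q :: "'a mat" where "Q = mat k (n + k) (\<lambda>(i, j). if j = n + i then 1 else 0)"
  have P: "P \<in> carrier_mat n (n + k)" and Q: "Q \<in> carrier_mat k (n + k)"
    by (auto simp: P_def Q_def)
  have Px: "(P *\<^sub>v x) $ i = x $ i" if "x \<in> carrier_vec (n + k)" "i < n" for x i
  proof -
    have "(P *\<^sub>v x) $ i = (\<Sum>j<n + k. if j = i then x $ j else 0)"
      unfolding index_mult_mat_vec_sum[OF P that]
      using that by (intro sum.cong refl) (auto simp: P_def)
    then show ?thesis using that by simp
  qed
  have Qx: "(Q *\<^sub>v x) $ i = x $ (n + i)" if "x \<in> carrier_vec (n + k)" "i < k" for x i
  proof -
    have "(Q *\<^sub>v x) $ i = (\<Sum>j<n + k. if j = n + i then x $ j else 0)"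
      unfolding index_mult_mat_vec_sum[OF Q that]
      using that by (intro sum.cong refl) (auto simp: Q_def)
    then show ?thesis using that by simp
  qed
  \<comment> \<open>Indices \<open>1..s\<close> carry the first system, \<open>s+1..s+t\<close> the
    second. A common zero has both projections zero.\<close>
  define h where "h j = (if j \<le> s then (\<lambda>x. f j (P *\<^sub>v x)) else (\<lambda>x. g (j - s) (Q *\<^sub>v x)))" for j
  have "quadratic_form (n + k) (h j)" if "j \<in> {1..s + t}" for j
    using that unfolding h_def
    by (auto intro!: quadratic_form_mult_mat_vec[OF f P] quadratic_form_mult_mat_vec[OF g Q])
  moreover have "x = 0\<^sub>v (n + k)"
    if x: "x \<in> carrier_vec (n + k)" and h0: "\<And>j. j \<in> {1..s + t} \<Longrightarrow> h j x = 0" for x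
  proof -
    have "f j (P *\<^sub>v x) = 0" if "j \<in> {1..s}" for j
      using h0[of j] that by (simp add: h_def)
    then have P0: "P *\<^sub>v x = 0\<^sub>v n" using f0 P x by simp
    have "g j (Q *\<^sub>v x) = 0" if "j \<in> {1..t}" for j
      using h0[of "s + j"] that by (simp add: h_def split: if_splits)
    then have Q0: "Q *\<^sub>v x = 0\<^sub>v k" using g0 Q x by simp
    show ?thesis
    proof (rule eq_vecI)
      fix i assume "i < dim_vec (0\<^sub>v (n + k))"
      then have i: "i < n + k" by simp
      show "x $ i = 0\<^sub>v (n + k) $ i"
        using Px[OF x, of i] Qx[OF x, of "i - n"] P0 Q0 i by (cases "i < n") auto
    qed (use x in simp)
  qed
  ultimately show ?thesis unfolding anisotropic_def by blast
qed

lemma anisotropic_mult: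
  assumes "anisotropic TYPE('a::field) s n"
  shows "anisotropic TYPE('a) (i * s) (i * n)"
proof (induction i)
  case (Suc i)
  then show ?case using anisotropic_add[OF assms Suc] by simp
qed (simp add: anisotropic_0)

section \<open>Totally isotropic subspaces and Leep's inequality\<close>

text \<open>Induction on \<open>d\<close>, splitting off one common zero per step. For positive
  \<open>d\<close> the size condition says \<open>n \<ge> N + 1 + (r + 1) * (d - 1)\<close>; it is
  rearranged to avoid truncated subtraction and to let \<open>d = 0\<close> be the base
  case.\<close>

lemma ex_totally_isotropic:
  fixes f :: "nat \<Rightarrow> 'a::field vec \<Rightarrow> 'a"
  assumes bound: "\<And>k. anisotropic TYPE('a) r k \<Longrightarrow> k \<le> N"
    and "\<And>j. j \<in> {1..r} \<Longrightarrow> quadratic_form n (f j)"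
    and "N + 1 + (r + 1) * d \<le> n + (r + 1)"
  shows "\<exists>V \<in> carrier_mat n d. inj_mat V \<and>
           (\<forall>y \<in> carrier_vec d. \<forall>j\<in>{1..r}. f j (V *\<^sub>v y) = 0)"
  using assms(2-)
proof (induction d arbitrary: n f)
  case 0
  have "f j (0\<^sub>v n) = 0" if j: "j \<in> {1..r}" for j
  proof -
    obtain B where "B \<in> carrier_mat n n" "f j (0\<^sub>v n) = 0\<^sub>v n \<bullet> (B *\<^sub>v 0\<^sub>v n)"
      using 0(1)[OF j] unfolding quadratic_form_iff_mat by fastforce
    then show ?thesis by simp
  qed
  moreover have "mat n 0 (\<lambda>_. 0) *\<^sub>v y = 0\<^sub>v n" if "y \<in> carrier_vec 0" for y :: "'a vec"
    using that by (auto simp: scalar_prod_def)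
  ultimately show ?case
    by (intro bexI[of _ "mat n 0 (\<lambda>_. 0)"]) (auto simp: inj_mat_def)
next
  case (Suc d)
  have "N < n" using Suc.prems(2) by simp
  then have "\<not> anisotropic TYPE('a) r n" using bound by fastforce
  then obtain v where v: "v \<in> carrier_vec n" "v \<noteq> 0\<^sub>v n" and fv: "\<And>j. j \<in> {1..r} \<Longrightarrow> f j v = 0"
    unfolding anisotropic_def using Suc.prems(1) by blast
  obtain k where k: "k < n" "v $ k \<noteq> 0"
    using v by (metis carrier_vecD eq_vecI index_zero_vec)
  have "\<exists>w. w \<in> carrier_vec n \<and> (\<forall>a. \<forall>x \<in> carrier_vec n.
      f j (a \<cdot>\<^sub>v v + x) = a * a * f j v + a * (w \<bullet> x) + f j x)" if "j \<in> {1..r}" for j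
    using quadratic_form_polar[OF Suc.prems(1)[OF that] v(1)] by metis
  then obtain w where w: "\<And>j. j \<in> {1..r} \<Longrightarrow> w j \<in> carrier_vec n"
    and polar: "\<And>j a x. j \<in> {1..r} \<Longrightarrow> x \<in> carrier_vec n \<Longrightarrow>
      f j (a \<cdot>\<^sub>v v + x) = a * a * f j v + a * (w j \<bullet> x) + f j x"
    by metis
  \<comment> \<open>Index 0 holds the coordinate functional that is nonzero at \<open>v\<close>. It
    keeps \<open>v\<close> out of the new subspace, because \<open>v\<close> itself is killed by all
    the polar functionals \<open>w i\<close>.\<close>
  define l where "l i = (if i = 0 then unit_vec n k else w i)" for i
  have "\<exists>P \<in> carrier_mat n (n - (r + 1)). inj_mat P \<and>
      (\<forall>y \<in> carrier_vec (n - (r + 1)). \<forall>i < r + 1. l i \<bullet> (P *\<^sub>v y) = 0)"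
    by (rule ex_inj_mat_kernel) (use w in \<open>simp add: l_def\<close>)
  then obtain P where P: "P \<in> carrier_mat n (n - (r + 1))" "inj_mat P"
    and lP: "\<forall>y \<in> carrier_vec (n - (r + 1)). \<forall>i < r + 1. l i \<bullet> (P *\<^sub>v y) = 0"
    by (elim bexE conjE) (rule that)
  \<comment> \<open>This holds even when \<open>n < r + 1\<close>, as truncation only enlarges the
    right-hand side.\<close>
  have "N + 1 + (r + 1) * d \<le> n - (r + 1) + (r + 1)"
    using Suc.prems(2) by simp
  then have "\<exists>V \<in> carrier_mat (n - (r + 1)) d. inj_mat V \<and>
      (\<forall>y \<in> carrier_vec d. \<forall>j\<in>{1..r}. f j (P *\<^sub>v (V *\<^sub>v y)) = 0)"
    using Suc.IH[of "n - (r + 1)" "\<lambda>j y. f j (P *\<^sub>v y)"]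
      quadratic_form_mult_mat_vec[OF Suc.prems(1) P(1)] by blast
  then obtain V where V: "V \<in> carrier_mat (n - (r + 1)) d" "inj_mat V"
    and fV: "\<And>y j. y \<in> carrier_vec d \<Longrightarrow> j \<in> {1..r} \<Longrightarrow> f j (P *\<^sub>v (V *\<^sub>v y)) = 0"
    by blast
  define U where "U = P * V"
  have U: "U \<in> carrier_mat n d" "inj_mat U"
    using P V inj_mat_mult[OF P(2,1) V(2,1)] by (auto simp: U_def)
  have Uy: "U *\<^sub>v y = P *\<^sub>v (V *\<^sub>v y)" if "y \<in> carrier_vec d" for y
    using that P V unfolding U_def by (simp add: assoc_mult_mat_vec[of _ n "n - (r + 1)"])
  have lU: "l i \<bullet> (U *\<^sub>v y) = 0" if "y \<in> carrier_vec d" "i < r + 1" for y i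
    using lP[rule_format, of "V *\<^sub>v y" i] that V Uy by simp
  \<comment> \<open>The column \<open>v\<close> is put in front of the basis \<open>U\<close> of the
    isotropic subspace found inside the common kernel.\<close>
  define W where "W = mat n (Suc d) (\<lambda>(i, j). if j = 0 then v $ i else U $$ (i, j - 1))"
  have W: "W \<in> carrier_mat n (Suc d)" by (simp add: W_def)
  let ?tl = "\<lambda>y. vec d (\<lambda>i. y $ Suc i)"
  have Wy: "W *\<^sub>v y = y $ 0 \<cdot>\<^sub>v v + U *\<^sub>v ?tl y" if y: "y \<in> carrier_vec (Suc d)" for y
  proof (rule eq_vecI)
    fix i assume "i < dim_vec (y $ 0 \<cdot>\<^sub>v v + U *\<^sub>v ?tl y)"
    then have i: "i < n" using U by simp
    have "(W *\<^sub>v y) $ i = (\<Sum>j<Suc d. (if j = 0 then v $ i else U $$ (i, j - 1)) * y $ j)"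
      unfolding index_mult_mat_vec_sum[OF W y i]
      using i by (intro sum.cong refl) (auto simp: W_def)
    also have "\<dots> = v $ i * y $ 0 + (\<Sum>j<d. U $$ (i, j) * y $ Suc j)"
      by (subst sum.lessThan_Suc_shift) simp
    also have "\<dots> = (y $ 0 \<cdot>\<^sub>v v + U *\<^sub>v ?tl y) $ i"
      using i U v by (simp add: index_mult_mat_vec_sum[OF U(1) _ i] del: index_mult_mat_vec)
    finally show "(W *\<^sub>v y) $ i = (y $ 0 \<cdot>\<^sub>v v + U *\<^sub>v ?tl y) $ i" .
  qed (use U v in \<open>simp add: W_def\<close>)
  \<comment> \<open>In the polar expansion all three terms vanish: \<open>v\<close> is a zero,
    \<open>U\<close> maps into the kernel of \<open>w j\<close>, and its image is isotropic.\<close>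
  have "f j (W *\<^sub>v y) = 0" if y: "y \<in> carrier_vec (Suc d)" and j: "j \<in> {1..r}" for y j
  proof -
    have "w j \<bullet> (U *\<^sub>v ?tl y) = 0" using lU[of "?tl y" j] j by (simp add: l_def)
    moreover have "f j (U *\<^sub>v ?tl y) = 0" using fV[of "?tl y" j] j Uy by simp
    moreover have "U *\<^sub>v ?tl y \<in> carrier_vec n" using U by simp
    ultimately show ?thesis unfolding Wy[OF y] using polar[OF j] fv[OF j] by simp
  qed
  \<comment> \<open>Coordinate \<open>k\<close> of \<open>W *\<^sub>v y\<close> is
    \<open>y $ 0 * v $ k\<close>, which forces \<open>y $ 0 = 0\<close>; injectivity of
    \<open>U\<close> handles the rest.\<close>
  moreover have "y = 0\<^sub>v (Suc d)" if y: "y \<in> carrier_vec (Suc d)" and W0: "W *\<^sub>v y = 0\<^sub>v n" for y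
  proof -
    have Uc: "U *\<^sub>v ?tl y \<in> carrier_vec n" using U by simp
    have "unit_vec n k \<bullet> (U *\<^sub>v ?tl y) = 0" using lU[of "?tl y" 0] by (simp add: l_def)
    then have "(U *\<^sub>v ?tl y) $ k = 0" using Uc k by simp
    moreover have "(y $ 0 \<cdot>\<^sub>v v + U *\<^sub>v ?tl y) $ k = 0" using W0 Wy[OF y] k by simp
    ultimately have y0: "y $ 0 = 0" using k U v by simp
    have "0 \<cdot>\<^sub>v v = 0\<^sub>v n" using v by (intro eq_vecI) auto
    then have "U *\<^sub>v ?tl y = 0\<^sub>v n" using W0 Wy[OF y] y0 Uc by simp
    then have tl0: "?tl y = 0\<^sub>v d" using inj_matD[OF U(2,1)] by simp
    show ?thesis
    proof (rule eq_vecI)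
      fix i assume i: "i < dim_vec (0\<^sub>v (Suc d))"
      show "y $ i = 0\<^sub>v (Suc d) $ i"
      proof (cases i)
        case (Suc j)
        then have "?tl y $ j = 0" using tl0 i by simp
        then show ?thesis using Suc i by simp
      qed (use y0 in simp)
    qed (use y in simp)
  qed
  ultimately show ?case using W by (intro bexI[of _ W]) (auto simp: inj_mat_def)
qed

text \<open>Were \<open>n\<close> larger, the first \<open>r\<close> forms would vanish on a
  subspace of dimension \<open>M + 1\<close>. The other \<open>m\<close> forms would have no
  nontrivial common zero there, contradicting the bound \<open>M\<close>.\<close>

lemma anisotropic_add_le:
  assumes r: "\<And>k. anisotropic TYPE('a::field) r k \<Longrightarrow> k \<le> N"
    and m: "\<And>k. anisotropic TYPE('a) m k \<Longrightarrow> k \<le> M"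
    and "anisotropic TYPE('a) (r + m) n"
  shows "n \<le> N + (r + 1) * M"
proof (rule ccontr)
  assume "\<not> n \<le> N + (r + 1) * M"
  then have n: "N + 1 + (r + 1) * Suc M \<le> n + (r + 1)" by simp
  obtain f :: "nat \<Rightarrow> 'a vec \<Rightarrow> 'a" where f: "\<And>j. j \<in> {1..r + m} \<Longrightarrow> quadratic_form n (f j)"
    and f0: "\<And>x. x \<in> carrier_vec n \<Longrightarrow> (\<And>j. j \<in> {1..r + m} \<Longrightarrow> f j x = 0) \<Longrightarrow> x = 0\<^sub>v n"
    using assms(3) unfolding anisotropic_def by blast
  obtain V where V: "V \<in> carrier_mat n (Suc M)" "inj_mat V"
    and fV: "\<And>y j. y \<in> carrier_vec (Suc M) \<Longrightarrow> j \<in> {1..r} \<Longrightarrow> f j (V *\<^sub>v y) = 0"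
    using ex_totally_isotropic[of r N n f "Suc M", OF r f n] by auto
  have "anisotropic TYPE('a) m (Suc M)"
    unfolding anisotropic_def
  proof (intro exI[of _ "\<lambda>j y. f (r + j) (V *\<^sub>v y)"] conjI ballI impI)
    fix j assume "j \<in> {1..m}"
    then show "quadratic_form (Suc M) (\<lambda>y. f (r + j) (V *\<^sub>v y))"
      using quadratic_form_mult_mat_vec[OF f V(1)] by simp
  next
    fix y assume y: "y \<in> carrier_vec (Suc M)" and fy: "\<forall>j\<in>{1..m}. f (r + j) (V *\<^sub>v y) = 0"
    have "f j (V *\<^sub>v y) = 0" if j: "j \<in> {1..r + m}" for j
    proof (cases "j \<le> r")
      case True
      then show ?thesis using fV[OF y] j by simp
    next
      case False
      then have "j - r \<in> {1..m}" "r + (j - r) = j" using j by auto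
      then show ?thesis using fy by metis
    qed
    then have "V *\<^sub>v y = 0\<^sub>v n" using f0 V y by simp
    then show "y = 0\<^sub>v (Suc M)" using inj_matD[OF V(2,1) y] by simp
  qed
  then show False using m by fastforce
qed

section \<open>The bound\<close>

text \<open>The \<open>s\<close> forms are padded with \<open>m - s\<close> copies of an anisotropic
  form in \<open>k\<close> fresh variables each, giving \<open>m\<close> forms in
  \<open>n + (m - s) * k\<close> variables.\<close>

lemma anisotropic_le_of_le:
  assumes "anisotropic TYPE('a::field) 1 k" and "\<And>n. anisotropic TYPE('a) m n \<Longrightarrow> n \<le> m * k"
    and "s \<le> m" and "anisotropic TYPE('a) s n"
  shows "n \<le> s * k"
proof -
  have "anisotropic TYPE('a) (s + (m - s)) (n + (m - s) * k)"
    using anisotropic_add[OF assms(4) anisotropic_mult[OF assms(1), of "m - s"]] by simp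
  then have "n + (m - s) * k \<le> m * k" using assms(2,3) by simp
  then show ?thesis using assms(3) by (simp add: diff_mult_distrib)
qed

text \<open>With \<open>t = q * m + s\<close>, the factor of \<open>real k\<close> is
  \<open>2 * s\<close> at \<open>q = 0\<close> and grows by \<open>2 * m * (t + 1)\<close> when
  \<open>t\<close> becomes \<open>t + m\<close>. That is exactly twice the increment in Leep's
  inequality, so equality with \<open>2 * real N\<close> persists.\<close>

lemma anisotropic_bound:
  assumes "anisotropic TYPE('a::field) 1 k" and m: "\<And>n. anisotropic TYPE('a) m n \<Longrightarrow> n \<le> m * k"
    and "s \<le> m"
  shows "\<exists>N. (\<forall>n. anisotropic TYPE('a) (q * m + s) n \<longrightarrow> n \<le> N) \<and>
    2 * real N = (real (q * m + s) * (real (q * m + s) - real m + 2) + real s * (real m - real s)) * real k"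
proof (induction q)
  case 0
  show ?case using anisotropic_le_of_le[OF assms]
    by (intro exI[of _ "s * k"]) (auto simp: algebra_simps)
next
  case (Suc q)
  then obtain N where N: "\<And>n. anisotropic TYPE('a) (q * m + s) n \<Longrightarrow> n \<le> N"
    "2 * real N = (real (q * m + s) * (real (q * m + s) - real m + 2) + real s * (real m - real s)) * real k"
    by blast
  have "n \<le> N + (q * m + s + 1) * (m * k)" if "anisotropic TYPE('a) (Suc q * m + s) n" for n
    using anisotropic_add_le[of "q * m + s" N m "m * k" n, OF N(1) m] that by (simp add: ac_simps)
  then show ?case using N(2)
    by (intro exI[of _ "N + (q * m + s + 1) * (m * k)"]) (auto simp: algebra_simps)
qed

theorem theorem1:
  fixes m t :: nat and \<tau> :: int
  assumes "m > 0"
    and "u_inv TYPE('a::field) m = enat m * u_inv TYPE('a) 1"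
    and "t > 0"
    and "1 \<le> \<tau>" and "\<tau> \<le> int m" and "[\<tau> = int t] (mod int m)"
  shows "ereal_of_enat (u_inv TYPE('a) t)
           \<le> ereal (1 / 2 * (real t * (real t - real m + 2) + real_of_int \<tau> * (real m - real_of_int \<tau>)))
               * ereal_of_enat (u_inv TYPE('a) 1)"
proof -
  define s where "s = nat \<tau>"
  have s: "\<tau> = int s" "1 \<le> s" "s \<le> m" using assms(4,5) by (auto simp: s_def)
  have cong: "[s = t] (mod m)" using assms(6) s by (simp add: cong_int_iff)
  \<comment> \<open>Otherwise \<open>m\<close> would divide \<open>s - t\<close>, which lies
    strictly between 0 and \<open>m\<close> because \<open>t > 0\<close> and
    \<open>s \<le> m\<close>.\<close>
  have "s \<le> t"
  proof (rule ccontr)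
    assume st: "\<not> s \<le> t"
    then have "m dvd s - t" using cong by (simp add: cong_altdef_nat)
    then have "m \<le> s - t" using st by (intro dvd_imp_le) auto
    then show False using s(3) assms(3) st by linarith
  qed
  then have "m dvd t - s" using cong by (metis cong_altdef_nat cong_sym)
  then obtain q where q: "t = q * m + s" using \<open>s \<le> t\<close> by (metis dvd_div_mult_self le_add_diff_inverse2)
  let ?c = "real t * (real t - real m + 2) + real_of_int \<tau> * (real m - real_of_int \<tau>)"
  show ?thesis
  proof (cases "u_inv TYPE('a) 1")
    case (enat k)
    have "u_inv TYPE('a) m \<le> enat (m * k)" using assms(2) enat by simp
    then have "\<And>n. anisotropic TYPE('a) m n \<Longrightarrow> n \<le> m * k" by (simp add: u_inv_le_iff)
    \<comment> \<open>Finiteness of \<open>u_inv\<close> at 1 provides an anisotropic form in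
      exactly \<open>k\<close> variables.\<close>
    from anisotropic_bound[OF anisotropic_u_inv[OF enat] this s(3), of q]
    obtain N where N: "\<forall>n. anisotropic TYPE('a) t n \<longrightarrow> n \<le> N" "2 * real N = ?c * real k"
      unfolding q s(1) by auto
    have "ereal_of_enat (u_inv TYPE('a) t) \<le> ereal_of_enat (enat N)"
      using N(1) by (simp only: ereal_of_enat_le_iff u_inv_le_iff)
    also have "\<dots> = ereal (1 / 2 * ?c) * ereal_of_enat (enat k)"
      using N(2) by simp
    finally show ?thesis using enat by simp
  next
    case infinity
    \<comment> \<open>Nonnegativity of \<open>?c\<close> would not be enough here, as \<open>0 * \<infinity> = 0\<close> in \<^typ>\<open>ereal\<close>.\<close>
    have "0 < ?c"
    proof (cases q)
      \<comment> \<open>Here \<open>t = s\<close>, and \<open>?c\<close> collapses to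
        \<open>2 * s\<close>.\<close>
      case 0
      then show ?thesis using q s by (simp add: algebra_simps)
    next
      case (Suc p)
      then have "m \<le> t" using q by simp
      then have "0 < real t * (real t - real m + 2)" using assms(3) by simp
      moreover have "0 \<le> real s * (real m - real s)" using s(3) by simp
      ultimately show ?thesis using s(1) by simp
    qed
    then show ?thesis using infinity by simp
  qed
qed

end
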